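(* Let $\ell\ge2$ and $d\ge1$ be integers. For any $\sigma\in\mathbb Z$, let $\mathsf z^\ell_{d,\sigma}(q)=\sum q^{\mathrm{rk}(|\boldsymbol\lambda,\boldsymbol\sigma\rangle)}$, summed over all charged $\ell$-partitions $|\boldsymbol\lambda,\boldsymbol\sigma\rangle$ with $\sigma_1+\dots+\sigma_\ell=\sigma$ that are spetsial $d$-cores, and let $\mathsf r^\ell_\sigma(q)=\sum q^{\mathrm{rk}(\boldsymbol\sigma)}$, summed over all $\boldsymbol\sigma\in\mathbb Z^\ell$ with $\sigma_1+\dots+\sigma_\ell=\sigma$. Then $$\mathsf z^\ell_{d,\sigma}(q)=\mathsf r^\ell_\sigma(q)\,\mathsf c_d(q)^\ell .$$
   Context: A partition $\lambda=(\lambda_1\ge\lambda_2\ge\cdots)$ is a weakly decreasing sequence of natural numbers with finitely many nonzero terms; $|\lambda|=\sum_i\lambda_i$. A partition is a $d$-core if it has no removable rim hook of length $d$; $\mathsf c_d(q)=\sum_{\lambda\ d\text{-core}}q^{|\lambda|}$. A charged $\ell$-partition $|\boldsymbol\lambda,\boldsymbol\sigma\rangle$ is a pair of an $\ell$-tuple $\boldsymbol\lambda=(\lambda^1,\dots,\lambda^\ell)$ of partitions and a charge $\boldsymbol\sigma=(\sigma_1,\dots,\sigma_\ell)\in\mathbb Z^\ell$; its symbol is $(S^{(1)},\dots,S^{(\ell)})$ with $S^{(j)}=\{\lambda^j_k-k+1+\sigma_j : k\ge1\}\subset\mathbb Z$. A spetsial $d$-hook is some $\beta\in S^{(j)}$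 with $\beta-d\notin S^{(j+1)}$ (superscripts mod $\ell$, so $S^{(\ell+1)}=S^{(1)}$). A charged $\ell$-partition is a spetsial $d$-core if its symbol has no spetsial $d$-hook. Rank of a charged $\ell$-partition: let $m=\max\{z\in\mathbb Z : z\notin S^{(j)}\text{ for some }j\}$, let $c$ be the number of pairs $(\beta,j)$ with $\beta\in S^{(j)}$, $\beta\ge m$, and put $\mathrm{rk}(|\boldsymbol\lambda,\boldsymbol\sigma\rangle)=\sum_{j}\sum_{\beta\in S^{(j)},\beta\ge m}\beta-cm-\left\lfloor\frac{(c-1)(c-\ell+1)}{2\ell}\right\rfloor$. Rank of a charge: $\mathrm{rk}(\boldsymbol\sigma)=\left\lceil\frac{Y-\ell+1}{2\ell}\right\rceil$ where $Y=\sum_{i=1}^{\ell}\sum_{j\ne i}\sigma_i(\sigma_i-\sigma_j)$.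
   Formalization: In the rank of a charged ℓ-partition, m is taken to be the minimum (not the maximum) of the integers z missing from some S^(j): the S^(j) are bounded above, so the maximum never exists; the rank is the same for any smaller m. *)

theory Defs
  imports Complex_Main "HOL-Computational_Algebra.Formal_Power_Series"
begin

section \<open>Partitions and d-cores\<close>

text \<open>All indices start at 0: the part \<open>lam k\<close> is the part usually written with index k + 1,
  and the components of an l-tuple (a list of length l) are numbered 0, ..., l - 1.\<close>

definition is_partition :: "(nat \<Rightarrow> nat) \<Rightarrow> bool" where
  "is_partition lam \<longleftrightarrow> antimono lam \<and> finite {k. lam k \<noteq> 0}"

definition partition_size :: "(nat \<Rightarrow> nat) \<Rightarrow> nat" where
  "partition_size lam = (\<Sum>k | lam k \<noteq> 0. lam k)"

definition young_diagram :: "(nat \<Rightarrow> nat) \<Rightarrow> (nat \<times> nat) set" where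
  "young_diagram lam = {(i, j). j < lam i}"

definition rim :: "(nat \<Rightarrow> nat) \<Rightarrow> (nat \<times> nat) set" where
  "rim lam = {(i, j) \<in> young_diagram lam. (Suc i, Suc j) \<notin> young_diagram lam}"

definition edge_adjacent :: "((nat \<times> nat) \<times> (nat \<times> nat)) set" where
  "edge_adjacent = {((i, j), (i', j')).
     \<bar>int i - int i'\<bar> + \<bar>int j - int j'\<bar> = 1}"

definition connected_cells :: "(nat \<times> nat) set \<Rightarrow> bool" where
  "connected_cells R \<longleftrightarrow> (\<forall>x\<in>R. \<forall>y\<in>R. (x, y) \<in> (edge_adjacent \<inter> R \<times> R)\<^sup>*)"

definition removable_rim_hook :: "(nat \<Rightarrow> nat) \<Rightarrow> (nat \<times> nat) set \<Rightarrow> bool" where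
  "removable_rim_hook lam R \<longleftrightarrow>
     R \<noteq> {} \<and> R \<subseteq> rim lam \<and> connected_cells R \<and>
     (\<exists>mu. is_partition mu \<and> young_diagram mu = young_diagram lam - R)"

definition d_cores :: "nat \<Rightarrow> (nat \<Rightarrow> nat) set" where
  "d_cores d = {lam. is_partition lam \<and> \<not> (\<exists>R. removable_rim_hook lam R \<and> card R = d)}"


section \<open>Charged l-partitions\<close>

type_synonym charged_multipartition = "(nat \<Rightarrow> nat) list \<times> int list"

definition charges :: "nat \<Rightarrow> int \<Rightarrow> int list set" where
  "charges l s = {sig. length sig = l \<and> sum_list sig = s}"

definition charged_partitions :: "nat \<Rightarrow> int \<Rightarrow> charged_multipartition set" where
  "charged_partitions l s =
     {(lams, sig). length lams = l \<and> (\<forall>lam\<in>set lams. is_partition lam) \<and> sig \<in> charges l s}"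

text \<open>With parts numbered from 0, the shift -k + 1 in the usual formula becomes -k.\<close>

definition symbol :: "charged_multipartition \<Rightarrow> nat \<Rightarrow> int set" where
  "symbol x j = {int ((fst x ! j) k) - int k + snd x ! j | k. True}"

definition spetsial_hook :: "nat \<Rightarrow> nat \<Rightarrow> charged_multipartition \<Rightarrow> nat \<Rightarrow> int \<Rightarrow> bool" where
  "spetsial_hook l d x j b \<longleftrightarrow>
     j < l \<and> b \<in> symbol x j \<and> b - int d \<notin> symbol x (Suc j mod l)"

definition spetsial_cores :: "nat \<Rightarrow> nat \<Rightarrow> int \<Rightarrow> charged_multipartition set" where
  "spetsial_cores l d s =
     {x \<in> charged_partitions l s. \<not> (\<exists>j b. spetsial_hook l d x j b)}"

text \<open>The components of a symbol contain all sufficiently small integers and no sufficiently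
  large ones, so the gap used in the rank is the smallest one; a largest one does not exist.
  (The rank would not change if the gap were replaced by any smaller integer.)\<close>

definition first_gap :: "nat \<Rightarrow> charged_multipartition \<Rightarrow> int" where
  "first_gap l x = (LEAST z. \<exists>j<l. z \<notin> symbol x j)"

definition rank :: "nat \<Rightarrow> charged_multipartition \<Rightarrow> int" where
  "rank l x =
     (let m = first_gap l x;
          c = int (card {(b, j). j < l \<and> b \<in> symbol x j \<and> m \<le> b})
      in (\<Sum>j<l. \<Sum>b | b \<in> symbol x j \<and> m \<le> b. b) - c * m
         - \<lfloor>real_of_int ((c - 1) * (c - int l + 1)) / real (2 * l)\<rfloor>)"

definition charge_rank :: "nat \<Rightarrow> int list \<Rightarrow> int" where
  "charge_rank l sig =
     (let Y = (\<Sum>i<l. \<Sum>j\<in>{..<l} - {i}. sig ! i * (sig ! i - sig ! j))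
      in \<lceil>real_of_int (Y - int l + 1) / real (2 * l)\<rceil>)"


section \<open>Generating series\<close>

text \<open>The sum of q to the power w x over all x in A is a formal power series exactly if all
  exponents are nonnegative and each of them occurs finitely often; the coefficient
  of the n-th power of q is then the number of x in A with w x = n.\<close>

definition has_gen_series :: "'a set \<Rightarrow> ('a \<Rightarrow> int) \<Rightarrow> bool" where
  "has_gen_series A w \<longleftrightarrow> (\<forall>x\<in>A. 0 \<le> w x) \<and> (\<forall>n. finite {x \<in> A. w x = n})"

definition gen_series :: "'a set \<Rightarrow> ('a \<Rightarrow> int) \<Rightarrow> int fps" where
  "gen_series A w = Abs_fps (\<lambda>n. int (card {x \<in> A. w x = int n}))"

definition spetsial_core_series :: "nat \<Rightarrow> nat \<Rightarrow> int \<Rightarrow> int fps" where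
  "spetsial_core_series l d s = gen_series (spetsial_cores l d s) (rank l)"

definition charge_series :: "nat \<Rightarrow> int \<Rightarrow> int fps" where
  "charge_series l s = gen_series (charges l s) (charge_rank l)"

definition core_series :: "nat \<Rightarrow> int fps" where
  "core_series d = gen_series (d_cores d) (\<lambda>lam. int (partition_size lam))"

end

theory Submission
  imports Defs "HOL-Library.Infinite_Set"
begin

text \<open>Record a charged multipartition by its symbol, an \<open>l\<close>-tuple of sets of integers. A spetsial
  hook compares \<open>b\<close> in component \<open>j\<close> with \<open>b - d\<close> in component \<open>j + 1\<close>. Move every \<open>b\<close> from
  component \<open>j\<close> to component \<open>j + (b div d)\<close> modulo \<open>l\<close>. This is a bijection on symbols, since
  for each \<open>b\<close> it permutes the components, and as \<open>(b - d) div d = b div d - 1\<close>, the elements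
  compared above end up in the same component. So the spetsial cores correspond to the symbols
  all of whose components are closed under subtracting \<open>d\<close> (\<open>spetsial_hook_twist\<close>).

  A partition is a \<open>d\<close>-core exactly if its beta-set is closed under subtracting \<open>d\<close>
  (\<open>d_core_iff_beta_set\<close>): removing a rim hook of length \<open>d\<close> is moving an element \<open>b\<close> of the
  beta-set to a vacant position \<open>b - d\<close>. Together with the fact that symbols determine charged
  multipartitions this gives a bijection from spetsial cores to pairs of an \<open>l\<close>-tuple of
  \<open>d\<close>-cores and an arbitrary charge (\<open>spetsial_cores_bij\<close>).

  The rank and the total charge only involve the multiset of all elements of the symbol, which
  the twist does not change (\<open>twist_invariants\<close>). Finally the rank is the sum of the sizes of the
  partitions and the rank of the charge (\<open>rank_eq\<close>), so the generating series factorises.\<close>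

section \<open>Generating series of products\<close>

lemma gen_series_transport:
  assumes bij: "bij_betw f A B" and w: "\<And>x. x \<in> A \<Longrightarrow> w x = v (f x)"
    and B: "has_gen_series B v"
  shows "has_gen_series A w \<and> gen_series A w = gen_series B v"
proof -
  have b: "bij_betw f {x \<in> A. w x = n} {y \<in> B. v y = n}" for n
    using bij w by (auto simp: bij_betw_def inj_on_def)
  have "has_gen_series A w"
    unfolding has_gen_series_def
  proof (intro conjI ballI allI)
    fix x assume "x \<in> A"
    then show "0 \<le> w x"
      using B w bij unfolding has_gen_series_def bij_betw_def by auto
  next
    fix n show "finite {x \<in> A. w x = n}"
      using B bij_betw_finite[OF b[of n]] by (simp add: has_gen_series_def)
  qed
  then show ?thesis
    using bij_betw_same_card[OF b] by (simp add: gen_series_def)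
qed

text \<open>Nonnegativity of both weights is what confines the pairs of total weight \<open>n\<close> to the
  finitely many splittings \<open>n = i + (n - i)\<close> of the Cauchy product.\<close>

lemma gen_series_Times:
  assumes A: "has_gen_series A v" and B: "has_gen_series B w"
  shows "has_gen_series (A \<times> B) (\<lambda>(a, b). v a + w b) \<and>
         gen_series (A \<times> B) (\<lambda>(a, b). v a + w b) = gen_series A v * gen_series B w"
proof -
  let ?X = "\<lambda>n. {p \<in> A \<times> B. (case p of (a, b) \<Rightarrow> v a + w b) = int n}"
  let ?A = "\<lambda>i. {a \<in> A. v a = int i}" and ?B = "\<lambda>i. {b \<in> B. w b = int i}"
  have posA: "0 \<le> v a" if "a \<in> A" for a using A that by (simp add: has_gen_series_def)
  have posB: "0 \<le> w b" if "b \<in> B" for b using B that by (simp add: has_gen_series_def)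
  have finA: "finite (?A i)" and finB: "finite (?B i)" for i
    using A B by (simp_all add: has_gen_series_def)
  have split: "?X n = (\<Union>i\<in>{0..n}. ?A i \<times> ?B (n - i))" for n
  proof (intro subset_antisym subsetI)
    fix p assume "p \<in> ?X n"
    then obtain a b where p: "p = (a, b)" "a \<in> A" "b \<in> B" "v a + w b = int n" by auto
    then have "nat (v a) \<le> n" "v a = int (nat (v a))" "w b = int (n - nat (v a))"
      using posA[of a] posB[of b] by auto
    then show "p \<in> (\<Union>i\<in>{0..n}. ?A i \<times> ?B (n - i))"
      using p by (intro UN_I[of "nat (v a)"]) simp_all
  qed auto
  have finX: "finite (?X n)" for n
    unfolding split by (intro finite_UN_I finite_cartesian_product finA finB) simp
  have card: "card (?X n) = (\<Sum>i=0..n. card (?A i) * card (?B (n - i)))" for n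
    unfolding split
  proof (subst card_UN_disjoint)
    show "\<forall>i\<in>{0..n}. finite (?A i \<times> ?B (n - i))"
      by (intro ballI finite_cartesian_product finA finB)
  qed (auto simp: card_cartesian_product)
  have "has_gen_series (A \<times> B) (\<lambda>(a, b). v a + w b)"
    unfolding has_gen_series_def
  proof (intro conjI ballI allI)
    fix p assume "p \<in> A \<times> B"
    then show "0 \<le> (case p of (a, b) \<Rightarrow> v a + w b)"
      using posA posB by (auto simp: add_nonneg_nonneg)
  next
    fix n :: int
    show "finite {p \<in> A \<times> B. (case p of (a, b) \<Rightarrow> v a + w b) = n}"
    proof (cases "0 \<le> n")
      case True
      then show ?thesis using finX[of "nat n"] by simp
    next
      case False
      then have "v a + w b \<noteq> n" if "a \<in> A" "b \<in> B" for a b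
        using posA[OF that(1)] posB[OF that(2)] by linarith
      then have "{p \<in> A \<times> B. (case p of (a, b) \<Rightarrow> v a + w b) = n} = {}"
        by auto
      then show ?thesis by (simp only: finite.emptyI)
    qed
  qed
  moreover have "gen_series (A \<times> B) (\<lambda>(a, b). v a + w b) = gen_series A v * gen_series B w"
    by (rule fps_ext) (simp only: gen_series_def fps_nth_Abs_fps fps_mult_nth card
        of_nat_sum of_nat_mult)
  ultimately show ?thesis ..
qed

lemma gen_series_lists:
  assumes B: "has_gen_series B w"
  shows "has_gen_series {xs. length xs = l \<and> set xs \<subseteq> B} (\<lambda>xs. sum_list (map w xs)) \<and>
         gen_series {xs. length xs = l \<and> set xs \<subseteq> B} (\<lambda>xs. sum_list (map w xs))
           = gen_series B w ^ l"
proof (induction l)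
  case 0
  have e: "{xs. length xs = 0 \<and> set xs \<subseteq> B} = {[]}" by auto
  have "finite {x. x = [] \<and> sum_list (map w x) = n}" for n
    by (rule finite_subset[of _ "{[]}"]) auto
  moreover have "{x. x = [] \<and> sum_list (map w x) = int n} = (if n = 0 then {[]} else {})" for n
    by auto
  ultimately show ?case
    unfolding e by (auto simp: has_gen_series_def gen_series_def fps_eq_iff)
next
  case (Suc l)
  let ?L = "\<lambda>l. {xs. length xs = l \<and> set xs \<subseteq> B}"
  have bij: "bij_betw (\<lambda>xs. (hd xs, tl xs)) (?L (Suc l)) (B \<times> ?L l)"
    by (rule bij_betw_byWitness[where f' = "\<lambda>(x, xs). x # xs"])
       (auto simp: length_Suc_conv)
  note p = gen_series_Times[OF B conjunct1[OF Suc.IH]]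
  have "has_gen_series (?L (Suc l)) (\<lambda>xs. sum_list (map w xs)) \<and>
     gen_series (?L (Suc l)) (\<lambda>xs. sum_list (map w xs))
       = gen_series (B \<times> ?L l) (\<lambda>(x, xs). w x + sum_list (map w xs))"
  proof (rule gen_series_transport[OF bij _ conjunct1[OF p]])
    fix xs assume "xs \<in> ?L (Suc l)"
    then show "sum_list (map w xs) = (case (hd xs, tl xs) of (x, xs) \<Rightarrow> w x + sum_list (map w xs))"
      by (cases xs) auto
  qed
  then show ?case using p Suc.IH by simp
qed

section \<open>Partitions and their beta-sets\<close>

lemma partition_size_eq_sum:
  assumes "\<And>k. k \<ge> N \<Longrightarrow> lam k = 0"
  shows "partition_size lam = (\<Sum>k<N. lam k)"
  unfolding partition_size_def
proof (rule sum.mono_neutral_left)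
  show "{k. lam k \<noteq> 0} \<subseteq> {..<N}"
  proof
    fix k assume "k \<in> {k. lam k \<noteq> 0}"
    then show "k \<in> {..<N}" using assms[of k] by (cases "k < N") auto
  qed
qed auto

lemma partition_eventually_zero:
  assumes "is_partition lam"
  obtains N where "\<And>k. k \<ge> N \<Longrightarrow> lam k = 0"
proof -
  obtain N where "\<forall>k\<in>{k. lam k \<noteq> 0}. k < N"
    using assms finite_nat_set_iff_bounded unfolding is_partition_def by metis
  then have "lam k = 0" if "k \<ge> N" for k using that leD by blast
  then show ?thesis by (rule that)
qed

text \<open>A partition of \<open>n\<close> has parts at most \<open>n\<close>, and part number \<open>k\<close> can be nonzero only if
  \<open>k < n\<close>, since then the parts \<open>0, \<dots>, k\<close> are all at least 1.\<close>

lemma finite_partitions_of_size: "finite {lam. is_partition lam \<and> partition_size lam = n}"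
proof (rule finite_subset)
  let ?F = "{f. \<forall>k. (k \<in> {..<n} \<longrightarrow> f k \<in> {..n}) \<and> (k \<notin> {..<n} \<longrightarrow> f k = 0)}"
  show "finite ?F" by (rule finite_set_of_finite_funs) auto
  show "{lam. is_partition lam \<and> partition_size lam = n} \<subseteq> ?F"
  proof (clarify, intro conjI impI)
    fix lam k assume lam: "is_partition lam"
    obtain N where N: "\<And>k. k \<ge> N \<Longrightarrow> lam k = 0"
      using partition_eventually_zero[OF lam] by blast
    have anti: "lam j \<le> lam i" if "i \<le> j" for i j
      using lam that by (auto simp: is_partition_def antimono_def)
    have sz: "partition_size lam = (\<Sum>k<N + Suc k. lam k)"
      by (rule partition_size_eq_sum) (use N in auto)
    show "lam k \<in> {..partition_size lam}"
      unfolding sz atMost_iff by (rule member_le_sum) auto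
    show "lam k = 0" if "k \<notin> {..<partition_size lam}"
    proof (rule ccontr)
      assume "lam k \<noteq> 0"
      then have "1 \<le> lam i" if "i < Suc k" for i
        using anti[of i k] that by simp
      then have "(\<Sum>i<Suc k. 1) \<le> (\<Sum>i<Suc k. lam i)"
        by (intro sum_mono) auto
      also have "\<dots> \<le> partition_size lam"
        unfolding sz by (rule sum_mono2) auto
      finally show False using that by simp
    qed
  qed
qed

lemma has_gen_series_d_cores: "has_gen_series (d_cores d) (\<lambda>lam. int (partition_size lam))"
  unfolding has_gen_series_def
proof (intro conjI ballI allI)
  fix n
  show "finite {lam \<in> d_cores d. int (partition_size lam) = n}"
    by (rule finite_subset[OF _ finite_partitions_of_size[of "nat n"]]) (auto simp: d_cores_def)
qed auto

definition beta_set :: "(nat \<Rightarrow> nat) \<Rightarrow> int \<Rightarrow> int set" where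
  "beta_set lam s = range (\<lambda>k. int (lam k) - int k + s)"

lemma symbol_eq_beta_set: "symbol x j = beta_set (fst x ! j) (snd x ! j)"
  by (auto simp: symbol_def beta_set_def)

lemma beta_strict:
  assumes "is_partition lam" and "i < k"
  shows "int (lam k) - int k + s < int (lam i) - int i + s"
proof -
  have "lam k \<le> lam i" using assms by (auto simp: is_partition_def antimono_def)
  then show ?thesis using assms(2) by linarith
qed

lemma strictly_decreasing_range_unique:
  fixes f g :: "nat \<Rightarrow> int"
  assumes f: "\<And>i k. i < k \<Longrightarrow> f k < f i" and g: "\<And>i k. i < k \<Longrightarrow> g k < g i"
    and eq: "range f = range g"
  shows "f n = g n"
proof (induction n rule: less_induct)
  case (less n)
  have le: "u n \<le> v n" if u: "\<And>i k. i < k \<Longrightarrow> u k < u i" and v: "\<And>i k. i < k \<Longrightarrow> v k < v i"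
    and eq: "range u = range v" and IH: "\<And>y. y < n \<Longrightarrow> u y = v y" for u v :: "nat \<Rightarrow> int"
  proof -
    obtain m where m: "u n = v m" using eq by (metis rangeE rangeI)
    have "\<not> m < n" using m IH[of m] u[of m n] by auto
    then show ?thesis using v[of n m] m by (cases "m = n") auto
  qed
  show ?case
  proof (rule order_antisym)
    show "f n \<le> g n" by (rule le[OF f g eq less.IH])
    show "g n \<le> f n" by (rule le[OF g f eq[symmetric] less.IH[symmetric]])
  qed
qed

lemma beta_set_inj:
  assumes lam: "is_partition lam" and mu: "is_partition mu"
    and eq: "beta_set lam s = beta_set mu t"
  shows "lam = mu \<and> s = t"
proof -
  have e: "int (lam k) - int k + s = int (mu k) - int k + t" for k
    by (rule strictly_decreasing_range_unique)
       (use beta_strict[OF lam] beta_strict[OF mu] eq in \<open>auto simp: beta_set_def\<close>)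
  obtain N where "\<And>k. k \<ge> N \<Longrightarrow> lam k = 0"
    using partition_eventually_zero[OF lam] by blast
  moreover obtain M where "\<And>k. k \<ge> M \<Longrightarrow> mu k = 0"
    using partition_eventually_zero[OF mu] by blast
  ultimately have "s = t" using e[of "N + M"] by simp
  then show ?thesis using e by (auto simp: fun_eq_iff)
qed

text \<open>The beta-sets of partitions, over all charges, are exactly the sets of this kind: a Maya
  diagram, filled far to the left and empty far to the right.\<close>

definition maya :: "int set \<Rightarrow> bool" where
  "maya S \<longleftrightarrow> (\<exists>a. \<forall>z<a. z \<in> S) \<and> (\<exists>b. \<forall>z\<in>S. z \<le> b)"

lemma maya_beta_set:
  assumes "is_partition lam"
  shows "maya (beta_set lam s)"
proof -
  obtain N where N: "\<And>k. k \<ge> N \<Longrightarrow> lam k = 0"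
    using partition_eventually_zero[OF assms] by blast
  have "z \<in> beta_set lam s" if "z < s - int N" for z
    unfolding beta_set_def by (rule image_eqI[of _ _ "nat (s - z)"]) (use that N in auto)
  moreover have "z \<le> int (lam 0) + s" if "z \<in> beta_set lam s" for z
  proof -
    obtain k where k: "z = int (lam k) - int k + s" using \<open>z \<in> beta_set lam s\<close> by (auto simp: beta_set_def)
    have "lam k \<le> lam 0" using assms by (auto simp: is_partition_def antimono_def)
    then show ?thesis using k by simp
  qed
  ultimately show ?thesis unfolding maya_def by blast
qed

text \<open>The elements of \<open>S\<close> listed in decreasing order are \<open>M - e 0, M - e 1, \<dots>\<close> for an upper
  bound \<open>M\<close> and a strictly increasing \<open>e\<close>. Since \<open>S\<close> is filled far to the left, \<open>e k - k\<close> is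
  weakly increasing and eventually constant; its limit determines the charge, and its distance
  from the limit is the partition.\<close>

lemma maya_eq_beta_set:
  assumes "maya S"
  shows "\<exists>lam s. is_partition lam \<and> beta_set lam s = S"
proof -
  obtain a M where a: "\<And>z. z < a \<Longrightarrow> z \<in> S" and M: "\<And>z. z \<in> S \<Longrightarrow> z \<le> M"
    using assms unfolding maya_def by blast
  define A where "A = {n::nat. M - int n \<in> S}"
  define N where "N = nat (M - a + 1)"
  have tail: "n \<in> A" if "n \<ge> N" for n
    using that a unfolding A_def N_def by auto
  have inf: "infinite A"
    unfolding infinite_nat_iff_unbounded_le
  proof
    fix n show "\<exists>k\<ge>n. k \<in> A" using tail[of "max n N"] by (intro exI[of _ "max n N"]) simp
  qed
  define e where "e = enumerate A"
  have mono: "strict_mono e" unfolding e_def by (rule strict_mono_enumerate[OF inf])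
  have rng: "range e = A" unfolding e_def by (rule range_enumerate[OF inf])
  have step: "e (Suc k) = Suc (e k)" if "k \<ge> N" for k
  proof -
    have "k \<le> e k" unfolding e_def by (rule le_enumerate[OF inf])
    then have "Suc (e k) \<in> A" using tail that by simp
    then obtain i where i: "e i = Suc (e k)" using rng by (metis rangeE)
    then have "k < i" using strict_mono_less[OF mono, of k i] by simp
    then have "e (Suc k) \<le> e i" using strict_mono_less_eq[OF mono] by simp
    moreover have "e k < e (Suc k)" using strict_mono_less[OF mono] by simp
    ultimately show ?thesis using i by simp
  qed
  define g where "g k = int (e k) - int k" for k
  have g_step: "g k \<le> g (Suc k)" for k
    using strict_mono_less[OF mono, of k "Suc k"] by (simp add: g_def)
  have g_mono: "i \<le> j \<Longrightarrow> g i \<le> g j" for i j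
    by (rule lift_Suc_mono_le[of g]) (use g_step in auto)
  have g_const: "g k = g N" if "k \<ge> N" for k
    using that by (induction k rule: dec_induct) (use step in \<open>auto simp: g_def\<close>)
  have g_le: "g k \<le> g N" for k
    using g_mono[of k N] g_const[of k] by (cases "k \<le> N") auto
  define lam where "lam k = nat (g N - g k)" for k
  have "is_partition lam"
    unfolding is_partition_def
  proof
    show "antimono lam"
      unfolding antimono_def lam_def using g_mono by (auto intro!: nat_mono)
    show "finite {k. lam k \<noteq> 0}"
    proof (rule finite_subset)
      show "{k. lam k \<noteq> 0} \<subseteq> {..<N}"
      proof
        fix k assume "k \<in> {k. lam k \<noteq> 0}"
        then have "g k \<noteq> g N" by (simp add: lam_def)
        then show "k \<in> {..<N}" using g_const[of k] by (cases "k < N") auto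
      qed
    qed simp
  qed
  moreover have "beta_set lam (M - g N) = S"
  proof -
    have "int (lam k) - int k + (M - g N) = M - int (e k)" for k
      using g_le[of k] by (simp add: lam_def g_def)
    then have "beta_set lam (M - g N) = (\<lambda>n. M - int n) ` A"
      by (simp only: beta_set_def rng[symmetric] image_image)
    also have "\<dots> = S"
    proof (intro subset_antisym subsetI)
      fix z assume "z \<in> S"
      then show "z \<in> (\<lambda>n. M - int n) ` A"
        using M[of z] by (intro image_eqI[of _ _ "nat (M - z)"]) (auto simp: A_def)
    qed (auto simp: A_def)
    finally show ?thesis .
  qed
  ultimately show ?thesis by blast
qed

text \<open>Far enough to the left the beta-set coincides with the one of the empty partition, so it
  suffices to compare both at a cutoff \<open>s - N\<close> where they agree and to subtract the full
  interval of integers \<open>L\<close> between that cutoff and \<open>m\<close>. The sum is doubled to keep the binomial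
  coefficient integral.\<close>

lemma beta_set_above:
  assumes lam: "is_partition lam" and m: "\<And>z. z < m \<Longrightarrow> z \<in> beta_set lam s"
  defines "U \<equiv> {b \<in> beta_set lam s. m \<le> b}"
  shows "finite U" and "int (card U) = s - m + 1"
    and "2 * (\<Sum>b\<in>U. b - m) = 2 * int (partition_size lam) + (s - m + 1) * (s - m)"
proof -
  define f where "f k = int (lam k) - int k + s" for k
  obtain N0 where N0: "\<And>k. k \<ge> N0 \<Longrightarrow> lam k = 0"
    using partition_eventually_zero[OF lam] by blast
  define N where "N = N0 + nat (s - m)+ 1"
  have zero: "lam k = 0" if "k \<ge> N" for k using N0 that by (simp add: N_def)
  have Nm: "s - int N < m" by (simp add: N_def)
  have dec: "f k < f i" if "i < k" for i k
    unfolding f_def using beta_strict[OF lam that] by simp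
  have inj: "inj f" by (rule linorder_injI) (use dec in force)
  have tail: "f k = s - int k" if "k \<ge> N" for k using zero[OF that] by (simp add: f_def)
  define L where "L = {s - int N + 1..m - 1}"
  have part: "f ` {..<N} = U \<union> L"
  proof (intro subset_antisym subsetI)
    fix b assume "b \<in> f ` {..<N}"
    then obtain k where k: "k < N" "b = f k" by auto
    then show "b \<in> U \<union> L"
      using dec[of k N] tail[of N] by (auto simp: U_def L_def beta_set_def f_def)
  next
    fix b assume b: "b \<in> U \<union> L"
    then have "b \<in> beta_set lam s" using m by (auto simp: U_def L_def)
    then obtain k where k: "b = f k" by (auto simp: beta_set_def f_def)
    have "b > s - int N" using b Nm by (auto simp: U_def L_def)
    then have "k < N" using tail[of k] k by (cases "k < N") auto
    then show "b \<in> f ` {..<N}" using k by auto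
  qed
  have fin: "finite (U \<union> L)" unfolding part[symmetric] by simp
  show fU: "finite U" using fin by simp
  have disj: "U \<inter> L = {}" by (auto simp: U_def L_def)
  have "N = card (U \<union> L)" unfolding part[symmetric] by (simp add: card_image inj_on_subset[OF inj])
  also have "\<dots> = card U + card L" by (rule card_Un_disjoint) (use fin disj in auto)
  finally show card: "int (card U) = s - m + 1" using Nm by (simp add: L_def)
  have gauss: "2 * (\<Sum>k<n. int k) = int n * (int n - 1)" for n
    by (induction n) (auto simp: algebra_simps)
  have "(\<Sum>b\<in>U. b - m) + (\<Sum>b\<in>L. b - m) = (\<Sum>b\<in>U \<union> L. b - m)"
    by (rule sum.union_disjoint[symmetric]) (use fin disj in auto)
  also have "\<dots> = (\<Sum>k<N. f k - m)"
    unfolding part[symmetric] by (subst sum.reindex) (auto intro: inj_on_subset[OF inj])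
  also have "\<dots> = int (partition_size lam) + int N * (s - m) - (\<Sum>k<N. int k)"
    using partition_size_eq_sum[OF zero]
    by (simp add: f_def sum.distrib sum_subtractf algebra_simps)
  finally have total: "2 * (\<Sum>b\<in>U. b - m) + 2 * (\<Sum>b\<in>L. b - m)
      = 2 * int (partition_size lam) + 2 * int N * (s - m) - int N * (int N - 1)"
    using gauss[of N] by (simp add: algebra_simps)
  define p where "p = nat (m - 1 - (s - int N))"
  have p: "int p = m - 1 - s + int N" using Nm by (simp add: p_def)
  have "(\<Sum>b\<in>L. b - m) = (\<Sum>k<p. - 1 - int k)"
    by (rule sum.reindex_bij_witness[of _ "\<lambda>k. m - 1 - int k" "\<lambda>b. nat (m - 1 - b)"])
       (auto simp: L_def p_def)
  also have "\<dots> = - int p - (\<Sum>k<p. int k)" by (simp add: sum_subtractf)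
  finally have "2 * (\<Sum>b\<in>L. b - m) = - 2 * int p - int p * (int p - 1)"
    using gauss[of p] by simp
  with total show "2 * (\<Sum>b\<in>U. b - m) = 2 * int (partition_size lam) + (s - m + 1) * (s - m)"
    unfolding p by (simp add: algebra_simps)
qed

section \<open>Rim hooks as moves in the beta-set\<close>

lemma rtrancl_crossing:
  assumes "(x, y) \<in> E\<^sup>*" and "P x" and "\<not> P y"
  shows "\<exists>u v. (u, v) \<in> E \<and> P u \<and> \<not> P v"
  using assms by (induction rule: rtrancl_induct) blast+

text \<open>A rim hook occupying the rows \<open>i, \<dots>, j\<close> is a strip in which consecutive rows overlap in
  exactly one column; this is the condition on \<open>lam (Suc k)\<close>. It makes the row lengths telescope
  to the difference of two entries of the beta-sets.\<close>

lemma card_strip: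
  assumes R: "R = (SIGMA k:{i..j}. {mu k..<lam k})" and "i \<le> j"
    and le: "\<And>k. mu k \<le> lam k"
    and glue: "\<And>k. i \<le> k \<Longrightarrow> k < j \<Longrightarrow> lam (Suc k) = Suc (mu k)"
  shows "int (card R) = (int (lam i) - int i) - (int (mu j) - int j)"
proof -
  have "int (card R) = (\<Sum>k=i..j. int (lam k) - int (mu k))"
    unfolding R using le by (simp add: of_nat_diff)
  moreover have "(\<Sum>k=i..n. int (lam k) - int (mu k)) = (int (lam i) - int i) - (int (mu n) - int n)"
    if "i \<le> n" "n \<le> j" for n
    using that
  proof (induction n rule: dec_induct)
    case (step n)
    then show ?case using glue[of n] by (simp add: sum.nat_ivl_Suc')
  qed simp
  ultimately show ?thesis using \<open>i \<le> j\<close> by simp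
qed

text \<open>Let the hook end in row \<open>j\<close>. Connectedness forces a vertical edge between any two of its
  consecutive rows, so they share a column; being in the rim they share only one. Hence the
  hook is a strip, and its length is \<open>d\<close> exactly if the entry \<open>b\<close> of its first row moves to the
  entry \<open>b - d\<close> of row \<open>j\<close> of the smaller partition. That position was vacant, because it lies
  strictly between the entries of \<open>lam\<close> for the rows \<open>j\<close> and \<open>Suc j\<close>.\<close>

lemma rim_hook_imp_beta_hook:
  assumes lam: "is_partition lam" and "removable_rim_hook lam R" and card: "card R = d"
    and "d \<ge> 1"
  shows "\<exists>b\<in>beta_set lam s. b - int d \<notin> beta_set lam s"
proof -
  obtain mu where rim: "R \<subseteq> rim lam" and conn: "connected_cells R" and mu: "is_partition mu"
    and diff: "young_diagram mu = young_diagram lam - R" and "R \<noteq> {}"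
    using assms(2) unfolding removable_rim_hook_def by blast
  have lam_mono: "lam k \<le> lam i" and mu_mono: "mu k \<le> mu i" if "i \<le> k" for i k
    using lam mu that by (auto simp: is_partition_def antimono_def)
  have sub: "R \<subseteq> young_diagram lam" using rim by (auto simp: rim_def)
  have mem: "(k, c) \<in> R \<longleftrightarrow> mu k \<le> c \<and> c < lam k" for k c
  proof -
    have "(k, c) \<in> young_diagram mu \<longleftrightarrow> (k, c) \<in> young_diagram lam \<and> (k, c) \<notin> R"
      using diff by blast
    moreover have "(k, c) \<in> R \<Longrightarrow> (k, c) \<in> young_diagram lam" using sub by blast
    ultimately show ?thesis by (auto simp: young_diagram_def)
  qed
  have le: "mu k \<le> lam k" for k
  proof (rule ccontr)
    assume "\<not> mu k \<le> lam k"
    then have "(k, lam k) \<in> young_diagram mu" by (simp add: young_diagram_def)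
    then have "(k, lam k) \<in> young_diagram lam" using diff by blast
    then show False by (simp add: young_diagram_def)
  qed
  have "finite R" using card \<open>d \<ge> 1\<close> by (metis card.infinite not_one_le_zero)
  then have fin: "finite (fst ` R)" by simp
  have ne: "fst ` R \<noteq> {}" using \<open>R \<noteq> {}\<close> by simp
  define i where "i = Min (fst ` R)"
  define j where "j = Max (fst ` R)"
  have ij: "i \<le> k \<and> k \<le> j" if "(k, c) \<in> R" for k c
    using that fin unfolding i_def j_def by (force intro: Min_le Max_ge)
  obtain ci where ci: "(i, ci) \<in> R" using Min_in[OF fin ne] unfolding i_def by force
  obtain cj where cj: "(j, cj) \<in> R" using Max_in[OF fin ne] unfolding j_def by force
  have "i \<le> j" using ij ci by blast
  have glue: "lam (Suc k) = Suc (mu k)" if k: "i \<le> k" "k < j" for k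
  proof -
    have "((i, ci), (j, cj)) \<in> (edge_adjacent \<inter> R \<times> R)\<^sup>*"
      using conn ci cj by (auto simp: connected_cells_def)
    from rtrancl_crossing[OF this, of "\<lambda>u. fst u \<le> k"] k
    obtain a b a' b' where e: "((a, b), (a', b')) \<in> edge_adjacent" "(a, b) \<in> R" "(a', b') \<in> R"
      "a \<le> k" "k < a'"
      by force
    then have "a = k" "a' = Suc k" "b' = b" by (auto simp: edge_adjacent_def)
    then have b: "mu k \<le> b" "b < lam k" "b < lam (Suc k)" using e mem by auto
    then have "(k, mu k) \<in> rim lam" using mem[of k "mu k"] rim by auto
    then have "\<not> Suc (mu k) < lam (Suc k)" by (auto simp: rim_def young_diagram_def)
    then show ?thesis using b by simp
  qed
  have "R = (SIGMA k:{i..j}. {mu k..<lam k})"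
  proof (intro subset_antisym subsetI)
    fix x assume "x \<in> R"
    then show "x \<in> (SIGMA k:{i..j}. {mu k..<lam k})"
      using ij mem by (cases x) auto
  qed (use mem in auto)
  from card_strip[OF this \<open>i \<le> j\<close> le glue]
  have d: "int d = (int (lam i) - int i) - (int (mu j) - int j)" using card by simp
  let ?b = "int (lam i) - int i + s"
  have "?b - int d \<notin> beta_set lam s"
  proof
    assume "?b - int d \<in> beta_set lam s"
    then obtain k where k: "int (mu j) - int j = int (lam k) - int k"
      using d by (auto simp: beta_set_def)
    show False
    proof (cases "k \<le> j")
      case True
      have "mu j < lam j" using cj mem[of j cj] by simp
      then show False using lam_mono[OF True] True k by simp
    next
      case False
      have "(Suc j, mu (Suc j)) \<notin> R" using ij by force
      then have "lam (Suc j) \<le> mu (Suc j)" using mem by auto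
      then show False using lam_mono[of "Suc j" k] mu_mono[of j "Suc j"] False k by simp
    qed
  qed
  then show ?thesis by (auto simp: beta_set_def)
qed

lemma connected_strip:
  assumes R: "R = (SIGMA k:{i..j}. {mu k..<lam k})"
    and lt: "\<And>k. i \<le> k \<Longrightarrow> k \<le> j \<Longrightarrow> mu k < lam k"
    and glue: "\<And>k. i \<le> k \<Longrightarrow> k < j \<Longrightarrow> lam (Suc k) = Suc (mu k)"
  shows "connected_cells R"
proof -
  let ?E = "edge_adjacent \<inter> R \<times> R"
  have "sym ?E" by (auto simp: sym_def edge_adjacent_def)
  then have sym: "(y, x) \<in> ?E\<^sup>*" if "(x, y) \<in> ?E\<^sup>*" for x y
    using that sym_rtrancl by (metis symD)
  have row: "((k, mu k), (k, c)) \<in> ?E\<^sup>*" if "(k, c) \<in> R" for k c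
  proof -
    have "mu k \<le> c" using that by (simp add: R)
    then show ?thesis using that
    proof (induction c rule: dec_induct)
      case (step c)
      then have "(k, c) \<in> R" by (simp add: R)
      moreover have "((k, c), (k, Suc c)) \<in> ?E"
        using \<open>(k, c) \<in> R\<close> step.prems by (auto simp: edge_adjacent_def)
      ultimately show ?case using step.IH by (meson rtrancl.rtrancl_into_rtrancl)
    qed simp
  qed
  have base: "((i, mu i), (k, mu k)) \<in> ?E\<^sup>*" if "i \<le> k" "k \<le> j" for k
    using that
  proof (induction k rule: dec_induct)
    case (step k)
    have "mu k < lam k" "mu (Suc k) < lam (Suc k)" "lam (Suc k) = Suc (mu k)"
      using lt[of k] lt[of "Suc k"] glue[of k] step by auto
    then have cells: "(k, mu k) \<in> R" "(Suc k, mu k) \<in> R"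
      using step by (auto simp: R)
    then have "((k, mu k), (Suc k, mu k)) \<in> ?E" by (auto simp: edge_adjacent_def)
    moreover have "((Suc k, mu k), (Suc k, mu (Suc k))) \<in> ?E\<^sup>*"
      by (rule sym[OF row[OF cells(2)]])
    moreover have "((i, mu i), (k, mu k)) \<in> ?E\<^sup>*" using step by simp
    ultimately show ?case by (meson rtrancl.rtrancl_into_rtrancl rtrancl_trans)
  qed simp
  have all: "((i, mu i), x) \<in> ?E\<^sup>*" if "x \<in> R" for x
  proof -
    obtain k c where x: "x = (k, c)" by (cases x)
    then have "i \<le> k" "k \<le> j" using that by (auto simp: R)
    from rtrancl_trans[OF base[OF this] row] that x show ?thesis by simp
  qed
  show ?thesis
    unfolding connected_cells_def using all sym by (meson rtrancl_trans)
qed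

text \<open>Moving the entry \<open>b\<close> of row \<open>i\<close> to the vacant position \<open>b - d\<close> and sorting again makes it
  the entry of some row \<open>j\<close>, while the entries in between move up by one row. The partition
  \<open>mu\<close> read off from this has the rim hook as its complement in \<open>lam\<close>.\<close>

lemma beta_hook_imp_rim_hook:
  assumes lam: "is_partition lam" and b: "b \<in> beta_set lam s" "b - int d \<notin> beta_set lam s"
    and "d \<ge> 1"
  shows "\<exists>R. removable_rim_hook lam R \<and> card R = d"
proof -
  obtain i where bi: "b = int (lam i) - int i + s" using b(1) by (auto simp: beta_set_def)
  \<comment> \<open>the vacant position, normalised to charge 0; row \<open>Suc j\<close> is the first one below it\<close>
  define t where "t = int (lam i) - int i - int d"
  have lam_mono: "lam k \<le> lam i" if "i \<le> k" for i k
    using lam that by (auto simp: is_partition_def antimono_def)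
  have t_ne: "int (lam k) - int k \<noteq> t" for k
  proof
    assume "int (lam k) - int k = t"
    then have "b - int d = int (lam k) - int k + s" using bi by (simp add: t_def)
    then show False using b(2) by (auto simp: beta_set_def)
  qed
  define k0 where "k0 = (LEAST k. int (lam k) - int k < t)"
  have "int (lam (lam 0 + nat (1 - t))) - int (lam 0 + nat (1 - t)) < t"
    using lam_mono[of 0 "lam 0 + nat (1 - t)"] by linarith
  then have k0: "int (lam k0) - int k0 < t" unfolding k0_def by (rule LeastI)
  have below: "t < int (lam k) - int k" if "k < k0" for k
    using not_less_Least[OF that[unfolded k0_def]] t_ne[of k] by simp
  have "i < k0"
  proof (rule ccontr)
    assume "\<not> i < k0"
    then show False using lam_mono[of k0 i] k0 \<open>d \<ge> 1\<close> by (simp add: t_def)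
  qed
  then obtain j where j: "k0 = Suc j" "i \<le> j" by (cases k0) auto
  have last: "int (lam (Suc j)) \<le> t + int j" using k0 j by simp
  have big: "t + int j < int (lam k)" if "k \<le> j" for k
    using below[of j] j lam_mono[OF that] by simp
  define mu where "mu k = (if k < i \<or> j < k then lam k else if k < j then lam (Suc k) - 1
    else nat (t + int j))" for k
  have mu_out: "mu k = lam k" if "k < i \<or> j < k" for k using that by (simp add: mu_def)
  have mu_j: "int (mu j) = t + int j" using last j by (simp add: mu_def)
  have glue: "lam (Suc k) = Suc (mu k)" if "i \<le> k" "k < j" for k
    using big[of "Suc k"] that last by (simp add: mu_def)
  have lt: "mu k < lam k" if "i \<le> k" "k \<le> j" for k
  proof (cases "k = j")
    case True
    then show ?thesis using big[of j] mu_j by simp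
  next
    case False
    then show ?thesis using glue[of k] lam_mono[of k "Suc k"] that by simp
  qed
  have le: "mu k \<le> lam k" for k
    using lt[of k] mu_out[of k] by (cases "i \<le> k \<and> k \<le> j") auto
  have step: "mu (Suc k) \<le> mu k" and above: "i \<le> k \<Longrightarrow> k \<le> j \<Longrightarrow> lam (Suc k) \<le> Suc (mu k)" for k
  proof -
    consider "k < i \<or> j < k" | "i \<le> k" "k < j" | "k = j" by linarith
    then have "mu (Suc k) \<le> mu k \<and> (i \<le> k \<longrightarrow> k \<le> j \<longrightarrow> lam (Suc k) \<le> Suc (mu k))"
    proof cases
      case 1
      then show ?thesis using mu_out[of k] le[of "Suc k"] lam_mono[of k "Suc k"] by auto
    next
      case 2
      then show ?thesis using glue[of k] lt[of "Suc k"] by simp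
    next
      case 3
      then show ?thesis using mu_j last mu_out[of "Suc j"] by simp
    qed
    then show "mu (Suc k) \<le> mu k" "i \<le> k \<Longrightarrow> k \<le> j \<Longrightarrow> lam (Suc k) \<le> Suc (mu k)" by auto
  qed
  have mu: "is_partition mu"
    unfolding is_partition_def
  proof
    show "antimono mu" using step by (simp add: decseq_Suc_iff)
    have "{k. mu k \<noteq> 0} \<subseteq> {k. lam k \<noteq> 0}"
    proof
      fix k assume "k \<in> {k. mu k \<noteq> 0}"
      then show "k \<in> {k. lam k \<noteq> 0}" using le[of k] by simp
    qed
    then show "finite {k. mu k \<noteq> 0}"
      using lam finite_subset by (auto simp: is_partition_def)
  qed
  define R where "R = (SIGMA k:{i..j}. {mu k..<lam k})"
  have "int (card R) = int d"
    using card_strip[OF R_def j(2) le glue] mu_j by (simp add: t_def)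
  moreover have "removable_rim_hook lam R"
    unfolding removable_rim_hook_def
  proof (intro conjI exI)
    have "(i, mu i) \<in> R" using lt[of i] j(2) by (simp add: R_def)
    then show "R \<noteq> {}" by blast
    show "R \<subseteq> rim lam"
    proof
      fix x assume "x \<in> R"
      then obtain k c where x: "x = (k, c)" "i \<le> k" "k \<le> j" "mu k \<le> c" "c < lam k"
        by (auto simp: R_def)
      then show "x \<in> rim lam"
        using above[of k] by (auto simp: rim_def young_diagram_def)
    qed
    show "connected_cells R" by (rule connected_strip[OF R_def lt glue])
    show "young_diagram mu = young_diagram lam - R"
    proof -
      have "c < mu k \<longleftrightarrow> c < lam k \<and> (k, c) \<notin> R" for k c
        using le[of k] mu_out[of k] by (auto simp: R_def)
      then show ?thesis by (auto simp: young_diagram_def)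
    qed
  qed (rule mu)
  ultimately show ?thesis by (intro exI[of _ R]) simp
qed

lemma d_core_iff_beta_set:
  assumes "is_partition lam" and "d \<ge> 1"
  shows "lam \<in> d_cores d \<longleftrightarrow> (\<forall>b\<in>beta_set lam s. b - int d \<in> beta_set lam s)"
  using assms rim_hook_imp_beta_hook[OF assms(1) _ _ assms(2)] beta_hook_imp_rim_hook[OF assms(1)]
  unfolding d_cores_def by blast

section \<open>Charged multipartitions and their symbols\<close>

definition charged :: "nat \<Rightarrow> charged_multipartition set" where
  "charged l = {(lams, sig). length lams = l \<and> length sig = l \<and> (\<forall>lam\<in>set lams. is_partition lam)}"

lemma charged_partitions_iff: "x \<in> charged_partitions l s \<longleftrightarrow> x \<in> charged l \<and> sum_list (snd x) = s"
  by (auto simp: charged_partitions_def charged_def charges_def)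

lemma charged_nth: "x \<in> charged l \<Longrightarrow> j < l \<Longrightarrow> is_partition (fst x ! j)"
  by (auto simp: charged_def)

lemma maya_symbol: "x \<in> charged l \<Longrightarrow> j < l \<Longrightarrow> maya (symbol x j)"
  unfolding symbol_eq_beta_set by (rule maya_beta_set[OF charged_nth])

lemma symbol_inj:
  assumes x: "x \<in> charged l" and y: "y \<in> charged l"
    and eq: "\<And>j. j < l \<Longrightarrow> symbol x j = symbol y j"
  shows "x = y"
proof -
  have "fst x ! j = fst y ! j \<and> snd x ! j = snd y ! j" if "j < l" for j
    using beta_set_inj[OF charged_nth[OF x that] charged_nth[OF y that]] eq[OF that]
    unfolding symbol_eq_beta_set by blast
  moreover have "length (fst x) = l" "length (fst y) = l" "length (snd x) = l" "length (snd y) = l"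
    using x y by (auto simp: charged_def)
  ultimately show ?thesis by (simp add: prod_eq_iff list_eq_iff_nth_eq)
qed

lemma symbol_surj:
  assumes "\<And>j. j < l \<Longrightarrow> maya (S j)"
  shows "\<exists>x\<in>charged l. \<forall>j<l. symbol x j = S j"
proof -
  have "\<forall>j\<in>{..<l}. \<exists>p. is_partition (fst p) \<and> beta_set (fst p) (snd p) = S j"
    using maya_eq_beta_set assms by simp
  then obtain p where p: "\<And>j. j < l \<Longrightarrow> is_partition (fst (p j)) \<and> beta_set (fst (p j)) (snd (p j)) = S j"
    using bchoice[of "{..<l}"] by (metis lessThan_iff)
  show ?thesis
    by (rule bexI[of _ "(map (fst \<circ> p) [0..<l], map (snd \<circ> p) [0..<l])"])
       (use p in \<open>auto simp: symbol_eq_beta_set charged_def\<close>)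
qed

definition from_symbol :: "nat \<Rightarrow> (nat \<Rightarrow> int set) \<Rightarrow> charged_multipartition" where
  "from_symbol l S = (THE x. x \<in> charged l \<and> (\<forall>j<l. symbol x j = S j))"

lemma from_symbol_eq:
  assumes "x \<in> charged l" and "\<And>j. j < l \<Longrightarrow> symbol x j = S j"
  shows "from_symbol l S = x"
  unfolding from_symbol_def
proof (rule the_equality)
  fix y assume "y \<in> charged l \<and> (\<forall>j<l. symbol y j = S j)"
  then show "y = x" using assms by (intro symbol_inj[of y l x]) auto
qed (use assms in auto)

lemma from_symbol:
  assumes "\<And>j. j < l \<Longrightarrow> maya (S j)"
  shows "from_symbol l S \<in> charged l" and "j < l \<Longrightarrow> symbol (from_symbol l S) j = S j"
proof -
  obtain x where x: "x \<in> charged l" "\<And>j. j < l \<Longrightarrow> symbol x j = S j"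
    using symbol_surj[of l S] assms by blast
  have "from_symbol l S = x" by (rule from_symbol_eq[OF x])
  then show "from_symbol l S \<in> charged l" and "j < l \<Longrightarrow> symbol (from_symbol l S) j = S j"
    using x by simp_all
qed

section \<open>The twist\<close>

definition rot :: "nat \<Rightarrow> nat \<Rightarrow> int \<Rightarrow> int \<Rightarrow> nat \<Rightarrow> nat" where
  "rot l d e b j = nat ((int j + e * (b div int d)) mod int l)"

text \<open>For \<open>e = - 1\<close> the element \<open>b\<close> of component \<open>j\<close> is sent to component \<open>j + (b div d)\<close> modulo
  \<open>l\<close>; the case \<open>e = 1\<close> is the inverse. The combination \<open>j + (b div d)\<close> does not change under
  \<open>(b, j) \<mapsto> (b - d, j + 1)\<close>, so the twist turns this diagonal step, on which spetsial hooks are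
  based, into a step within one component.\<close>

definition twist :: "nat \<Rightarrow> nat \<Rightarrow> int \<Rightarrow> (nat \<Rightarrow> int set) \<Rightarrow> nat \<Rightarrow> int set" where
  "twist l d e S j = {b. b \<in> S (rot l d e b j)}"

lemma int_rot: "l > 0 \<Longrightarrow> int (rot l d e b j) = (int j + e * (b div int d)) mod int l"
  by (simp add: rot_def)

lemma rot_less: "l > 0 \<Longrightarrow> rot l d e b j < l"
  by (simp add: rot_def nat_less_iff)

lemma rot_rot: "j < l \<Longrightarrow> rot l d (- e) b (rot l d e b j) = j"
  by (simp add: rot_def mod_simps)

lemma twist_twist: "j < l \<Longrightarrow> twist l d e (twist l d (- e) S) j = S j"
  by (auto simp: twist_def rot_rot)

lemma twist_cong: "(\<And>j. j < l \<Longrightarrow> S j = T j) \<Longrightarrow> l > 0 \<Longrightarrow> twist l d e S j = twist l d e T j"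
  using rot_less by (auto simp: twist_def)

lemma maya_twist:
  assumes "\<And>j. j < l \<Longrightarrow> maya (S j)" and "l > 0"
  shows "maya (twist l d e S j)"
proof -
  obtain a b where a: "\<And>j z. j < l \<Longrightarrow> z < a j \<Longrightarrow> z \<in> S j" and b: "\<And>j z. j < l \<Longrightarrow> z \<in> S j \<Longrightarrow> z \<le> b j"
    using assms(1) unfolding maya_def by metis
  have "z \<in> twist l d e S j" if "z < Min (a ` {..<l})" for z
  proof -
    have "Min (a ` {..<l}) \<le> a (rot l d e z j)" using rot_less[OF assms(2)] by (intro Min_le) auto
    then have "z < a (rot l d e z j)" using that by simp
    then show ?thesis using a rot_less[OF assms(2)] by (simp add: twist_def)
  qed
  moreover have "z \<le> Max (b ` {..<l})" if "z \<in> twist l d e S j" for z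
  proof -
    have "z \<le> b (rot l d e z j)" using that b rot_less[OF assms(2)] by (auto simp: twist_def)
    also have "\<dots> \<le> Max (b ` {..<l})" using rot_less[OF assms(2)] by (intro Max_ge) auto
    finally show ?thesis .
  qed
  ultimately show ?thesis unfolding maya_def by blast
qed

text \<open>Subtracting \<open>d\<close> from \<open>b\<close> lowers \<open>b div d\<close> by one, so in the twisted symbol \<open>b\<close> and \<open>b - d\<close>
  lie in the same component if they come from neighbouring components.\<close>

lemma spetsial_hook_twist:
  assumes "l > 0" and "d \<ge> 1"
  shows "(\<exists>j b. spetsial_hook l d x j b) \<longleftrightarrow>
    (\<exists>c<l. \<exists>b\<in>twist l d (- 1) (symbol x) c. b - int d \<notin> twist l d (- 1) (symbol x) c)"
proof -
  have shift: "rot l d (- 1) (b - int d) c = Suc (rot l d (- 1) b c) mod l" for b c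
  proof -
    have "(b - int d) div int d = b div int d - 1"
      using assms(2) div_mult_self1[of "int d" b "- 1"] by simp
    then have "int (rot l d (- 1) (b - int d) c) = (int c - b div int d + 1) mod int l"
      unfolding int_rot[OF assms(1)] by (intro arg_cong[of _ _ "\<lambda>z. z mod int l"]) simp
    also have "\<dots> = int (Suc (rot l d (- 1) b c) mod l)"
      unfolding zmod_int of_nat_Suc int_rot[OF assms(1)]
      by (simp add: mod_simps algebra_simps)
    finally show ?thesis by simp
  qed
  show ?thesis
  proof
    assume "\<exists>j b. spetsial_hook l d x j b"
    then obtain j b where h: "j < l" "b \<in> symbol x j" "b - int d \<notin> symbol x (Suc j mod l)"
      by (auto simp: spetsial_hook_def)
    have "rot l d (- 1) b (rot l d 1 b j) = j" using rot_rot[OF h(1)] .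
    then show "\<exists>c<l. \<exists>b\<in>twist l d (- 1) (symbol x) c. b - int d \<notin> twist l d (- 1) (symbol x) c"
      using h rot_less[OF assms(1)] shift
      by (intro exI[of _ "rot l d 1 b j"] conjI bexI[of _ b]) (auto simp: twist_def)
  next
    assume "\<exists>c<l. \<exists>b\<in>twist l d (- 1) (symbol x) c. b - int d \<notin> twist l d (- 1) (symbol x) c"
    then obtain c b where "b \<in> symbol x (rot l d (- 1) b c)"
      "b - int d \<notin> symbol x (Suc (rot l d (- 1) b c) mod l)"
      by (auto simp: twist_def shift)
    then have "spetsial_hook l d x (rot l d (- 1) b c) b"
      using rot_less[OF assms(1)] by (simp add: spetsial_hook_def)
    then show "\<exists>j b. spetsial_hook l d x j b" by blast
  qed
qed

section \<open>The rank\<close>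

definition beads :: "nat \<Rightarrow> charged_multipartition \<Rightarrow> int \<Rightarrow> (int \<times> nat) set" where
  "beads l x m = {(b, j). j < l \<and> b \<in> symbol x j \<and> m \<le> b}"

lemma sum_beads:
  assumes x: "x \<in> charged l"
  shows "(\<Sum>j<l. \<Sum>b | b \<in> symbol x j \<and> m \<le> b. g b) = (\<Sum>p\<in>beads l x m. g (fst p))"
proof -
  have fin: "finite {b \<in> symbol x j. m \<le> b}" if j: "j < l" for j
  proof -
    obtain M where "\<forall>z\<in>symbol x j. z \<le> M" using maya_symbol[OF x j] by (auto simp: maya_def)
    then have "{b \<in> symbol x j. m \<le> b} \<subseteq> {m..M}" by auto
    then show ?thesis by (rule finite_subset) simp
  qed
  have "(\<Sum>j<l. \<Sum>b | b \<in> symbol x j \<and> m \<le> b. g b)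
      = (\<Sum>(j, b)\<in>(SIGMA j:{..<l}. {b \<in> symbol x j. m \<le> b}). g b)"
    by (rule sum.Sigma) (use fin in auto)
  also have "\<dots> = (\<Sum>p\<in>beads l x m. g (fst p))"
    by (rule sum.reindex_bij_witness[of _ "\<lambda>(b, j). (j, b)" "\<lambda>(j, b). (b, j)"])
       (auto simp: beads_def)
  finally show ?thesis .
qed

lemma rank_beads:
  assumes "x \<in> charged l"
  shows "rank l x = (let m = first_gap l x; c = int (card (beads l x m)) in
    (\<Sum>p\<in>beads l x m. fst p) - c * m - \<lfloor>real_of_int ((c - 1) * (c - int l + 1)) / real (2 * l)\<rfloor>)"
  unfolding rank_def sum_beads[OF assms, where g = "\<lambda>b. b"] by (simp add: beads_def)

text \<open>The integers are not well-ordered, so the value of \<open>first_gap\<close>, a least integer, rests on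
  the gaps being bounded below.\<close>

lemma ex_least_int:
  fixes Q :: "int \<Rightarrow> bool"
  assumes "Q z" and "\<And>w. w < a \<Longrightarrow> \<not> Q w"
  shows "\<exists>m. Q m \<and> (\<forall>w<m. \<not> Q w)"
proof -
  have "a \<le> z" using assms by force
  then have "Q (a + int (nat (z - a)))" using assms(1) by simp
  from LeastI[of "\<lambda>n. Q (a + int n)", OF this]
  have "Q (a + int (LEAST n. Q (a + int n)))" .
  moreover have "\<not> Q w" if "w < a + int (LEAST n. Q (a + int n))" for w
  proof (cases "w < a")
    case False
    then have "nat (w - a) < (LEAST n. Q (a + int n))" using that by linarith
    from not_less_Least[OF this] show ?thesis using False by simp
  qed (use assms in auto)
  ultimately show ?thesis by blast
qed

lemma below_first_gap:
  assumes x: "x \<in> charged l" and l: "l > 0" and "z < first_gap l x" and "j < l"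
  shows "z \<in> symbol x j"
proof -
  let ?Q = "\<lambda>z. \<exists>j<l. z \<notin> symbol x j"
  have maya: "\<And>j. j < l \<Longrightarrow> maya (symbol x j)" using maya_symbol[OF x] .
  obtain M where "\<forall>z\<in>symbol x 0. z \<le> M" using maya[OF l] by (auto simp: maya_def)
  then have top: "?Q (M + 1)" using l by force
  obtain a where a: "\<And>j z. j < l \<Longrightarrow> z < a j \<Longrightarrow> z \<in> symbol x j"
    using maya unfolding maya_def by metis
  have "\<not> ?Q w" if "w < Min (a ` {..<l})" for w
  proof -
    have "w < a j" if "j < l" for j
    proof -
      have "Min (a ` {..<l}) \<le> a j" using that by (intro Min_le) auto
      then show ?thesis using \<open>w < Min (a ` {..<l})\<close> by simp
    qed
    then show ?thesis using a by blast
  qed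
  from ex_least_int[of ?Q, OF top this] obtain m where m: "?Q m" "\<forall>w<m. \<not> ?Q w" by blast
  have "first_gap l x = m"
    unfolding first_gap_def by (rule Least_equality) (use m in \<open>auto simp: not_less[symmetric]\<close>)
  then show ?thesis using m assms by blast
qed

lemma card_beads:
  assumes x: "x \<in> charged l" and l: "l > 0"
  shows "int (card (beads l x (first_gap l x))) = (\<Sum>j<l. snd x ! j - first_gap l x + 1)"
proof -
  let ?m = "first_gap l x"
  have "int (card {b \<in> symbol x j. ?m \<le> b}) = snd x ! j - ?m + 1" if "j < l" for j
    unfolding symbol_eq_beta_set
    by (rule beta_set_above[OF charged_nth[OF x that]])
       (use below_first_gap[OF x l _ that] in \<open>simp add: symbol_eq_beta_set\<close>)
  then show ?thesis
    using sum_beads[OF x, of "\<lambda>_. 1 :: int" ?m] by simp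
qed

text \<open>The total charge is expressed by the elements of the symbol alone, irrespective of the
  components they lie in; this makes it visible that the twist preserves it.\<close>

lemma sum_list_charge:
  assumes x: "x \<in> charged l" and l: "l > 0"
  shows "sum_list (snd x) = int (card (beads l x (first_gap l x))) + int l * (first_gap l x - 1)"
proof -
  have "length (snd x) = l" using x by (auto simp: charged_def)
  then show ?thesis
    unfolding card_beads[OF x l]
    by (simp add: sum_list_sum_nth atLeast0LessThan sum.distrib sum_subtractf algebra_simps)
qed

text \<open>For each fixed integer \<open>b\<close> the twist merely permutes the components. Gaps, the number of
  elements above them and their sum only depend on how many components contain each \<open>b\<close>.\<close>

lemma twist_invariants:
  assumes x: "x \<in> charged l" and y: "y \<in> charged l" and l: "l > 0"
    and eq: "\<And>j. j < l \<Longrightarrow> symbol y j = twist l d e (symbol x) j"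
  shows "rank l y = rank l x" and "sum_list (snd y) = sum_list (snd x)"
proof -
  have conv: "symbol x j = twist l d (- e) (symbol y) j" if "j < l" for j
    using twist_cong[OF eq l, where d = d and e = "- e" and j = j] twist_twist[OF that, of d "- e" "symbol x"] by simp
  have y_iff: "b \<in> symbol y j \<longleftrightarrow> b \<in> symbol x (rot l d e b j)"
    and x_iff: "b \<in> symbol x j \<longleftrightarrow> b \<in> symbol y (rot l d (- e) b j)" if "j < l" for b j
    unfolding eq[OF that] conv[OF that] by (simp_all add: twist_def)
  have "(\<exists>j<l. z \<notin> symbol y j) \<longleftrightarrow> (\<exists>j<l. z \<notin> symbol x j)" for z
    using y_iff x_iff rot_less[OF l] by meson
  then have gap: "first_gap l y = first_gap l x" by (simp add: first_gap_def)
  have bij: "bij_betw (\<lambda>(b, j). (b, rot l d e b j)) (beads l y m) (beads l x m)" for m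
  proof (rule bij_betw_byWitness[where f' = "\<lambda>(b, j). (b, rot l d (- e) b j)"])
    show "(\<lambda>(b, j). (b, rot l d e b j)) ` beads l y m \<subseteq> beads l x m"
      using y_iff rot_less[OF l] by (auto simp: beads_def)
    show "(\<lambda>(b, j). (b, rot l d (- e) b j)) ` beads l x m \<subseteq> beads l y m"
      using x_iff rot_less[OF l] by (auto simp: beads_def)
  qed (use rot_rot[of _ l d e] rot_rot[of _ l d "- e"] in \<open>auto simp: beads_def\<close>)
  have card: "card (beads l y m) = card (beads l x m)" for m by (rule bij_betw_same_card[OF bij])
  have "(\<Sum>p\<in>beads l y m. fst p) = (\<Sum>p\<in>beads l x m. fst p)" for m
    by (subst sum.reindex_bij_betw[OF bij, symmetric]) (simp add: case_prod_unfold)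
  then show "rank l y = rank l x" by (simp add: rank_beads[OF x] rank_beads[OF y] gap card)
  show "sum_list (snd y) = sum_list (snd x)"
    by (simp add: sum_list_charge[OF x l] sum_list_charge[OF y l] gap card)
qed

text \<open>The diagonal terms vanish, so the sum may run over all pairs.\<close>

lemma charge_form:
  fixes f :: "nat \<Rightarrow> int"
  shows "(\<Sum>i<l. \<Sum>j\<in>{..<l} - {i}. f i * (f i - f j)) = int l * (\<Sum>i<l. (f i)\<^sup>2) - (\<Sum>i<l. f i)\<^sup>2"
proof -
  have "(\<Sum>j\<in>{..<l} - {i}. f i * (f i - f j)) = int l * (f i)\<^sup>2 - f i * (\<Sum>j<l. f j)" if "i < l" for i
  proof -
    have "(\<Sum>j\<in>{..<l} - {i}. f i * (f i - f j)) = (\<Sum>j<l. f i * (f i - f j))"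
      by (rule sum.mono_neutral_left) auto
    then show ?thesis by (simp add: algebra_simps sum_subtractf sum_distrib_left power2_eq_square)
  qed
  then have "(\<Sum>i<l. \<Sum>j\<in>{..<l} - {i}. f i * (f i - f j))
      = (\<Sum>i<l. int l * (f i)\<^sup>2 - f i * (\<Sum>j<l. f j))" by simp
  then show ?thesis
    by (simp add: sum_subtractf sum_distrib_left[symmetric] sum_distrib_right[symmetric] power2_eq_square)
qed

text \<open>Measured from the first gap \<open>m\<close>, the charges become the numbers \<open>n j\<close> of elements of the
  components that are at least \<open>m\<close>, and \<open>c\<close> is their sum. Each component contributes the size
  of its partition and \<open>n j * (n j - 1) div 2\<close>; the latter add up to \<open>D\<close>. The quadratic form in
  the rank of a charge is invariant under adding the same integer to all charges, so it can be
  evaluated at the \<open>n j\<close>, where it equals \<open>2 * l * D - X + l - 1\<close> for the numerator \<open>X\<close> inside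
  the floor. Since \<open>D\<close> is an integer, the ceiling is \<open>D\<close> minus that floor.\<close>

lemma rank_eq:
  assumes x: "x \<in> charged l" and l: "l > 0"
  shows "rank l x = sum_list (map (\<lambda>lam. int (partition_size lam)) (fst x)) + charge_rank l (snd x)"
proof -
  define m where "m = first_gap l x"
  define n where "n j = snd x ! j - m + 1" for j
  define c where "c = (\<Sum>j<l. n j)"
  define D where "D = (\<Sum>j<l. n j * (n j - 1) div 2)"
  define X where "X = (c - 1) * (c - int l + 1)"
  define z where "z j = int (partition_size (fst x ! j))" for j
  have c: "int (card (beads l x m)) = c"
    unfolding m_def c_def n_def by (rule card_beads[OF x l])
  have even: "2 * (n j * (n j - 1) div 2) = n j * (n j - 1)" for j by simp
  have D: "2 * D = (\<Sum>j<l. n j * (n j - 1))"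
    unfolding D_def sum_distrib_left by (simp only: even)
  have col: "(\<Sum>b | b \<in> symbol x j \<and> m \<le> b. b - m) = z j + n j * (n j - 1) div 2"
    if j: "j < l" for j
  proof -
    have "2 * (\<Sum>b\<in>{b \<in> symbol x j. m \<le> b}. b - m) = 2 * z j + n j * (n j - 1)"
      unfolding symbol_eq_beta_set n_def z_def m_def
      by (subst beta_set_above(3)[OF charged_nth[OF x j]])
         (use below_first_gap[OF x l _ j] in \<open>simp_all add: symbol_eq_beta_set\<close>)
    then show ?thesis using even[of j] by linarith
  qed
  have "(\<Sum>p\<in>beads l x m. fst p) - c * m = (\<Sum>p\<in>beads l x m. fst p - m)"
    by (simp add: sum_subtractf c)
  also have "\<dots> = (\<Sum>j<l. z j + n j * (n j - 1) div 2)"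
    unfolding sum_beads[OF x, where g = "\<lambda>b. b - m", symmetric] by (intro sum.cong refl) (simp add: col)
  finally have beads: "(\<Sum>p\<in>beads l x m. fst p) - c * m = (\<Sum>j<l. z j) + D"
    by (simp add: D_def sum.distrib)
  have len: "length (fst x) = l" using x by (auto simp: charged_def)
  have sz: "sum_list (map (\<lambda>lam. int (partition_size lam)) (fst x)) = (\<Sum>j<l. z j)"
    by (simp add: sum_list_sum_nth len z_def atLeast0LessThan)
  have sig: "snd x ! j = n j + (m - 1)" for j by (simp add: n_def)
  have Y: "(\<Sum>i<l. \<Sum>j\<in>{..<l} - {i}. snd x ! i * (snd x ! i - snd x ! j)) - int l + 1 = 2 * int l * D - X"
  proof -
    have "(\<Sum>i<l. \<Sum>j\<in>{..<l} - {i}. snd x ! i * (snd x ! i - snd x ! j))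
        = (\<Sum>i<l. \<Sum>j\<in>{..<l} - {i}. (n i + (m - 1)) * (n i - n j))"
      unfolding sig by simp
    also have "\<dots> = (\<Sum>i<l. \<Sum>j\<in>{..<l} - {i}. n i * (n i - n j)) + (m - 1) * (\<Sum>i<l. \<Sum>j\<in>{..<l} - {i}. n i - n j)"
      by (simp add: distrib_right sum.distrib sum_distrib_left)
    also have "(\<Sum>i<l. \<Sum>j\<in>{..<l} - {i}. n i - n j) = (\<Sum>i<l. \<Sum>j<l. n i - n j)"
      by (intro sum.cong refl sum.mono_neutral_left) auto
    also have "\<dots> = 0" by (simp add: sum_subtractf sum_distrib_left)
    also have "(\<Sum>i<l. \<Sum>j\<in>{..<l} - {i}. n i * (n i - n j)) = int l * (\<Sum>i<l. (n i)\<^sup>2) - c\<^sup>2"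
      unfolding c_def by (rule charge_form)
    also have "(\<Sum>i<l. (n i)\<^sup>2) = 2 * D + c"
      unfolding D c_def by (simp add: algebra_simps power2_eq_square sum_subtractf)
    finally show ?thesis by (simp add: X_def algebra_simps power2_eq_square)
  qed
  have "charge_rank l (snd x) = \<lceil>real_of_int (2 * int l * D - X) / real (2 * l)\<rceil>"
    unfolding charge_rank_def Let_def Y ..
  also have "real_of_int (2 * int l * D - X) / real (2 * l) = real_of_int D - real_of_int X / real (2 * l)"
    using l by (simp add: field_simps)
  also have "\<lceil>\<dots>\<rceil> = D - \<lfloor>real_of_int X / real (2 * l)\<rfloor>"
    by (simp add: ceiling_def)
  finally have "charge_rank l (snd x) = D - \<lfloor>real_of_int X / real (2 * l)\<rfloor>" .
  moreover have "rank l x = (\<Sum>p\<in>beads l x m. fst p) - c * m - \<lfloor>real_of_int X / real (2 * l)\<rfloor>"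
    unfolding rank_beads[OF x] Let_def m_def[symmetric] c X_def ..
  ultimately show ?thesis unfolding sz beads by simp
qed

text \<open>With the total charge fixed, the quadratic form \<open>Y\<close> is half the sum of all squared
  differences of charges, hence nonnegative, and it is \<open>l * (\<Sum>i<l. (sig ! i)\<^sup>2)\<close> up to a constant,
  so a bound on it leaves finitely many charges. The ceiling is nonnegative because
  \<open>(Y - l + 1) / (2 * l) > - 1\<close>.\<close>

lemma has_gen_series_charges:
  assumes l: "l > 0"
  shows "has_gen_series (charges l s) (charge_rank l)"
proof -
  define Y where "Y sig = int l * (\<Sum>i<l. (sig ! i)\<^sup>2) - s\<^sup>2" for sig :: "int list"
  have rk: "charge_rank l sig = \<lceil>real_of_int (Y sig - int l + 1) / real (2 * l)\<rceil>"
    if "sig \<in> charges l s" for sig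
  proof -
    have "(\<Sum>i<l. sig ! i) = s"
      using that by (auto simp: charges_def sum_list_sum_nth atLeast0LessThan)
    then show ?thesis unfolding charge_rank_def charge_form Let_def Y_def by simp
  qed
  have Y_nonneg: "0 \<le> Y sig" if "sig \<in> charges l s" for sig
  proof -
    have s: "(\<Sum>i<l. sig ! i) = s"
      using that by (auto simp: charges_def sum_list_sum_nth atLeast0LessThan)
    have "0 \<le> (\<Sum>i<l. \<Sum>j<l. (sig ! i - sig ! j)\<^sup>2)" by (intro sum_nonneg) simp
    also have "\<dots> = 2 * Y sig"
      unfolding Y_def s[symmetric]
      by (simp add: power2_diff sum.distrib sum_subtractf sum_distrib_left[symmetric]
          sum_distrib_right[symmetric] power2_eq_square algebra_simps)
    finally show ?thesis by simp
  qed
  show ?thesis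
    unfolding has_gen_series_def
  proof (intro conjI ballI allI)
    fix sig assume sig: "sig \<in> charges l s"
    have "- 1 < real_of_int (Y sig - int l + 1) / real (2 * l)"
      using Y_nonneg[OF sig] l by (simp add: field_simps)
    then show "0 \<le> charge_rank l sig" unfolding rk[OF sig] by linarith
  next
    fix n
    define B where "B = 2 * int l * n + int l + s\<^sup>2"
    have "{sig \<in> charges l s. charge_rank l sig = n} \<subseteq> {sig. set sig \<subseteq> {- B..B} \<and> length sig = l}"
    proof safe
      fix sig t assume sig: "sig \<in> charges l s" and n: "n = charge_rank l sig" and t: "t \<in> set sig"
      have "real_of_int (Y sig - int l + 1) / real (2 * l) \<le> real_of_int n"
        unfolding n rk[OF sig] by linarith
      then have "real_of_int (Y sig - int l + 1) \<le> real_of_int (2 * int l * n)"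
        using l by (simp add: field_simps)
      then have Y: "Y sig - int l + 1 \<le> 2 * int l * n" by (simp only: of_int_le_iff)
      obtain i where i: "i < l" "t = sig ! i"
        using t sig by (auto simp: in_set_conv_nth charges_def)
      have "\<bar>t\<bar> \<le> t\<^sup>2"
        using self_le_power[of "\<bar>t\<bar>" 2] by (cases "t = 0") auto
      also have "t\<^sup>2 \<le> (\<Sum>i<l. (sig ! i)\<^sup>2)"
        unfolding i(2) by (rule member_le_sum) (use i in auto)
      also have "\<dots> \<le> int l * (\<Sum>i<l. (sig ! i)\<^sup>2)"
        using l sum_nonneg[of "{..<l}" "\<lambda>i. (sig ! i)\<^sup>2"] by (intro mult_le_cancel_right1[THEN iffD2]) auto
      also have "\<dots> \<le> B" using Y by (simp add: Y_def B_def)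
      finally show "t \<in> {- B..B}" by auto
    qed (auto simp: charges_def)
    then show "finite {sig \<in> charges l s. charge_rank l sig = n}"
      by (rule finite_subset) (simp add: finite_lists_length_eq)
  qed
qed

section \<open>From spetsial cores to tuples of cores\<close>

text \<open>After the twist, the absence of spetsial hooks says that every component is closed under
  subtracting \<open>d\<close>, that is, every component is the beta-set of a core.\<close>

lemma spetsial_cores_bij:
  assumes l: "l > 0" and d: "d \<ge> 1"
  defines "f \<equiv> \<lambda>x. from_symbol l (twist l d (- 1) (symbol x))"
  shows "bij_betw f (spetsial_cores l d s)
           ({lams. length lams = l \<and> set lams \<subseteq> d_cores d} \<times> charges l s)"
    and "x \<in> spetsial_cores l d s \<Longrightarrow> rank l (f x) = rank l x"
    and "x \<in> spetsial_cores l d s \<Longrightarrow> f x \<in> charged l"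
proof -
  let ?C = "{lams. length lams = l \<and> set lams \<subseteq> d_cores d} \<times> charges l s"
  define g where "g y = from_symbol l (twist l d 1 (symbol y))" for y
  have f: "f x \<in> charged l" "\<And>j. j < l \<Longrightarrow> symbol (f x) j = twist l d (- 1) (symbol x) j"
    and g: "g x \<in> charged l" "\<And>j. j < l \<Longrightarrow> symbol (g x) j = twist l d 1 (symbol x) j"
    if "x \<in> charged l" for x
    unfolding f_def g_def using from_symbol maya_twist maya_symbol that l by metis+
  have gf: "g (f x) = x" and fg: "f (g x) = x" if "x \<in> charged l" for x
  proof -
    show "g (f x) = x"
      unfolding g_def
    proof (rule from_symbol_eq[OF that])
      fix j assume "j < l"
      then show "symbol x j = twist l d 1 (symbol (f x)) j"
        using twist_cong[OF f(2)[OF that] l] twist_twist[of j l d 1] by simp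
    qed
    show "f (g x) = x"
      unfolding f_def
    proof (rule from_symbol_eq[OF that])
      fix j assume "j < l"
      then show "symbol x j = twist l d (- 1) (symbol (g x)) j"
        using twist_cong[OF g(2)[OF that] l] twist_twist[of j l d "- 1"] by simp
    qed
  qed
  have C_iff: "y \<in> ?C \<longleftrightarrow> y \<in> charged l \<and> sum_list (snd y) = s \<and>
      (\<forall>c<l. \<forall>b\<in>symbol y c. b - int d \<in> symbol y c)" for y
  proof -
    have "(\<forall>lam\<in>set (fst y). lam \<in> d_cores d) \<longleftrightarrow> (\<forall>c<l. \<forall>b\<in>symbol y c. b - int d \<in> symbol y c)"
      if "y \<in> charged l"
    proof -
      have "length (fst y) = l" using that by (auto simp: charged_def)
      then show ?thesis
        using d_core_iff_beta_set[OF charged_nth[OF that] d]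
        by (simp add: all_set_conv_all_nth symbol_eq_beta_set)
    qed
    moreover have "y \<in> ?C \<Longrightarrow> y \<in> charged l"
      by (cases y) (auto simp: charged_def charges_def d_cores_def)
    moreover have "y \<in> ?C \<longleftrightarrow> length (fst y) = l \<and> (\<forall>lam\<in>set (fst y). lam \<in> d_cores d) \<and>
        length (snd y) = l \<and> sum_list (snd y) = s"
      by (cases y) (auto simp: charges_def)
    ultimately show ?thesis by (auto simp: charged_def)
  qed
  have S_iff: "x \<in> spetsial_cores l d s \<longleftrightarrow> x \<in> charged l \<and> sum_list (snd x) = s \<and>
      (\<forall>c<l. \<forall>b\<in>twist l d (- 1) (symbol x) c. b - int d \<in> twist l d (- 1) (symbol x) c)" for x
    using spetsial_hook_twist[OF l d, of x]
    by (auto simp: spetsial_cores_def charged_partitions_iff)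
  have fC: "f x \<in> ?C \<longleftrightarrow> x \<in> spetsial_cores l d s" if x: "x \<in> charged l" for x
    unfolding C_iff S_iff
    using f[OF x] x twist_invariants(2)[OF x f(1)[OF x] l f(2)[OF x]] by simp
  show "bij_betw f (spetsial_cores l d s) ?C"
  proof (rule bij_betw_byWitness[where f' = g])
    show "\<forall>x\<in>spetsial_cores l d s. g (f x) = x" using gf S_iff by blast
    show "\<forall>y\<in>?C. f (g y) = y" using fg C_iff by blast
    show "f ` spetsial_cores l d s \<subseteq> ?C" using fC S_iff by blast
    show "g ` ?C \<subseteq> spetsial_cores l d s"
    proof
      fix x assume "x \<in> g ` ?C"
      then obtain y where y: "y \<in> ?C" "x = g y" by blast
      then have "y \<in> charged l" using C_iff by blast
      then show "x \<in> spetsial_cores l d s" using y fC[of "g y"] g(1) fg by simp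
    qed
  qed
  assume x: "x \<in> spetsial_cores l d s"
  then have xc: "x \<in> charged l" using S_iff by blast
  show "f x \<in> charged l" by (rule f(1)[OF xc])
  show "rank l (f x) = rank l x" by (rule twist_invariants(1)[OF xc f(1)[OF xc] l f(2)[OF xc]])
qed

theorem proposition4p15:
  fixes l d :: nat and s :: int
  assumes "l \<ge> 2" and "d \<ge> 1"
  shows "has_gen_series (spetsial_cores l d s) (rank l) \<and>
         has_gen_series (charges l s) (charge_rank l) \<and>
         has_gen_series (d_cores d) (\<lambda>lam. int (partition_size lam)) \<and>
         spetsial_core_series l d s = charge_series l s * core_series d ^ l"
proof -
  have l: "l > 0" using assms(1) by simp
  let ?L = "{lams. length lams = l \<and> set lams \<subseteq> d_cores d}"
  let ?size = "\<lambda>lam. int (partition_size lam)"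
  note cores = has_gen_series_d_cores[of d]
  note charges = has_gen_series_charges[OF l, of s]
  note lists = gen_series_lists[OF cores, of l]
  note prod = gen_series_Times[OF conjunct1[OF lists] charges]
  note bij = spetsial_cores_bij[OF l assms(2), where s = s]
  have "has_gen_series (spetsial_cores l d s) (rank l) \<and> gen_series (spetsial_cores l d s) (rank l)
      = gen_series (?L \<times> charges l s) (\<lambda>(lams, sig). sum_list (map ?size lams) + charge_rank l sig)"
  proof (rule gen_series_transport[OF bij(1) _ conjunct1[OF prod]])
    fix x assume x: "x \<in> spetsial_cores l d s"
    show "rank l x = (case from_symbol l (twist l d (- 1) (symbol x)) of
        (lams, sig) \<Rightarrow> sum_list (map ?size lams) + charge_rank l sig)"
      unfolding bij(2)[OF x, symmetric] rank_eq[OF bij(3)[OF x] l] by (simp add: case_prod_unfold)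
  qed
  then show ?thesis
    using cores charges lists prod
    by (simp add: spetsial_core_series_def charge_series_def core_series_def mult.commute)
qed

end
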